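(* Let $\Gamma$ be a confusion graph and $\Theta$ an approximation graph on the same finite source alphabet $\mathcal{X}$. Then the approximate-guess maximal leakage rate $\mathcal{L}_\Theta$ satisfies $$\log\frac{p_f(\Theta)}{\max_{T\in\mathcal{I}_{\max}(\Gamma)}k_f(\mathcal{H}_1(T))}\le\mathcal{L}_\Theta\le\log\chi_f(\Gamma).$$
   Context: Graphs are finite, simple and undirected. The confusion graph $\Gamma$ and the adversary's approximation graph $\Theta$ both have vertex set $\mathcal{X}$, the finite alphabet of a discrete memoryless stationary source (so $P_{X^t}(x^t)=\prod_jP_X(x_j)$). For a positive integer $t$, $\Gamma_t=\Gamma^{\lor t}$ is the graph on $\mathcal{X}^t$ in which $x^t,v^t$ are adjacent iff $\{x_j,v_j\}$ is an edge of $\Gamma$ for some $j$. $\Theta_t=\Theta^{\boxtimes t}$ is the graph on $\mathcal{X}^t$ in which distinct $x^t,v^t$ are adjacent iff for every $j$, $x_j=v_j$ or $\{x_j,v_j\}$ is an edge of $\Theta$. $N(\Theta_t,x^t)$ is the closed neighborhood of $x^t$ in $\Theta_t$ (including $x^t$), and $\Theta_1=\Theta$. $\mathcal{I}_{\max}(G)$ is the set of inclusion-maximal independent sets of $G$. A mapping scheme is a conditional distribution $P_{Y|X^t}$ from $\mathcal{X}^t$ to a finite code alphabet $\mathcal{Y}$ (which may be chosen freely); it is valid if for every $y$ the set $\{x^t: P_{Y|X^t}(y|x^t)>0\}$ is an independent set of $\Gamma_t$. The approximate-guess maximal leakage of a valid mapping is $$L^t_\Theta(P_{Y|X^t})=\log\max_{P_X}\frac{\sum_{y\in\mathcal{Y}}\max_{x^t\in\mathcal{X}^t}\sum_{\tilde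 x^t\in N(\Theta_t,x^t)}P_{X^t}(\tilde x^t)P_{Y|X^t}(y|\tilde x^t)}{\max_{x^t\in\mathcal{X}^t}\sum_{\tilde x^t\in N(\Theta_t,x^t)}P_{X^t}(\tilde x^t)},$$ the outer maximum being over all probability distributions $P_X$ on $\mathcal{X}$. The approximate-guess maximal leakage rate is $\mathcal{L}_\Theta=\lim_{t\to\infty}\frac1t\inf L^t_\Theta(P_{Y|X^t})$, the infimum being over valid mappings for length $t$; the limit is assumed to exist. For $T\in\mathcal{I}_{\max}(\Gamma_t)$, the associated hypergraph $\mathcal{H}_t(T)$ has vertex set $T$ and hyperedges all nonempty sets of the form $T\cap N(\Theta_t,x^t)$ with $x^t\in\mathcal{X}^t$. For a hypergraph $\mathcal{H}$, a $b$-fold covering is a multiset of hyperedges such that every vertex is in at least $b$ of them; $k_b(\mathcal{H})$ is the least cardinality (with multiplicity) of a $b$-fold covering, and $k_f(\mathcal{H})=\inf_bk_b(\mathcal{H})/b$ is the fractional covering number. The fractional closed neighborhood packing number $p_f(\Theta)$ is the maximum of $\sum_{x\in\mathcal{X}}\lambda(x)$ over $\lambda:\mathcal{X}\to[0,1]$ with $\sum_{\tilde x\in N(\Theta,x)}\lambda(\tilde x)\le1$ for every $x\in\mathcal{X}$. The fractional chromatic number is $\chi_f(G)=\inf_b\chi_b(G)/b$, where $\chi_b(G)$ is the least $m$ for which there is a multiset of $m$ independent sets of $G$ with every vertex in exactly $b$ of them. The logarithm has a fixed base greater than 1. *)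

theory Defs
  imports
    "HOL-Library.Multiset"
    "HOL-Probability.Probability_Mass_Function"
    "Graph_Theory.Pair_Digraph"
begin

(* Finite simple undirected graphs are the symmetric loop-free digraphs of the locale
   pair_graph; an undirected edge is the pair of its two opposite arcs. *)

definition closed_nbhd :: "'v pair_pre_digraph \<Rightarrow> 'v \<Rightarrow> 'v set" where
  "closed_nbhd G x = {v \<in> pverts G. v = x \<or> (x, v) \<in> parcs G}"

definition indep_set :: "'v pair_pre_digraph \<Rightarrow> 'v set \<Rightarrow> bool" where
  "indep_set G S \<longleftrightarrow> S \<subseteq> pverts G \<and> (\<forall>u\<in>S. \<forall>v\<in>S. (u, v) \<notin> parcs G)"

definition max_indep_sets :: "'v pair_pre_digraph \<Rightarrow> 'v set set" where
  "max_indep_sets G = {S. indep_set G S \<and> (\<forall>S'. indep_set G S' \<and> S \<subseteq> S' \<longrightarrow> S' = S)}"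

definition words :: "'a set \<Rightarrow> nat \<Rightarrow> 'a list set" where
  "words X t = {xs. set xs \<subseteq> X \<and> length xs = t}"

definition or_power :: "'a pair_pre_digraph \<Rightarrow> nat \<Rightarrow> 'a list pair_pre_digraph" where
  "or_power G t = \<lparr>
     pverts = words (pverts G) t,
     parcs = {(x, v). x \<in> words (pverts G) t \<and> v \<in> words (pverts G) t \<and>
                      (\<exists>j<t. (x ! j, v ! j) \<in> parcs G)} \<rparr>"

definition strong_power :: "'a pair_pre_digraph \<Rightarrow> nat \<Rightarrow> 'a list pair_pre_digraph" where
  "strong_power G t = \<lparr>
     pverts = words (pverts G) t,
     parcs = {(x, v). x \<in> words (pverts G) t \<and> v \<in> words (pverts G) t \<and> x \<noteq> v \<and>
                      (\<forall>j<t. x ! j = v ! j \<or> (x ! j, v ! j) \<in> parcs G)} \<rparr>"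

(* A code alphabet is a finite set of naturals: up to renaming of symbols this covers every
   finite alphabet. The conditional distribution given a word x is K x; the values of K
   outside the source words are irrelevant. *)
definition valid_mapping ::
    "'a pair_pre_digraph \<Rightarrow> nat \<Rightarrow> nat set \<Rightarrow> ('a list \<Rightarrow> nat pmf) \<Rightarrow> bool" where
  "valid_mapping \<Gamma> t Y K \<longleftrightarrow>
     finite Y \<and> (\<forall>x \<in> words (pverts \<Gamma>) t. set_pmf (K x) \<subseteq> Y) \<and>
     (\<forall>y\<in>Y. indep_set (or_power \<Gamma> t) {x \<in> words (pverts \<Gamma>) t. pmf (K x) y > 0})"

definition word_prob :: "'a pmf \<Rightarrow> 'a list \<Rightarrow> real" where
  "word_prob P xs = (\<Prod>j<length xs. pmf P (xs ! j))"

(* The outer SUP is a maximum: the quotient is a continuous function of P on the compact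
   simplex of distributions on the source alphabet, its denominator being positive there. *)
definition approx_leakage ::
    "real \<Rightarrow> 'a pair_pre_digraph \<Rightarrow> nat \<Rightarrow> nat set \<Rightarrow> ('a list \<Rightarrow> nat pmf) \<Rightarrow> real" where
  "approx_leakage \<beta> \<Theta> t Y K =
     log \<beta> (SUP P\<in>{P. set_pmf P \<subseteq> pverts \<Theta>}.
       (\<Sum>y\<in>Y. MAX x\<in>words (pverts \<Theta>) t.
           \<Sum>x'\<in>closed_nbhd (strong_power \<Theta> t) x. word_prob P x' * pmf (K x') y) /
       (MAX x\<in>words (pverts \<Theta>) t.
           \<Sum>x'\<in>closed_nbhd (strong_power \<Theta> t) x. word_prob P x'))"

definition opt_leakage ::
    "real \<Rightarrow> 'a pair_pre_digraph \<Rightarrow> 'a pair_pre_digraph \<Rightarrow> nat \<Rightarrow> real" where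
  "opt_leakage \<beta> \<Gamma> \<Theta> t = Inf {approx_leakage \<beta> \<Theta> t Y K | Y K. valid_mapping \<Gamma> t Y K}"

(* Meaningful only if the sequence of normalised leakages converges. *)
definition leakage_rate ::
    "real \<Rightarrow> 'a pair_pre_digraph \<Rightarrow> 'a pair_pre_digraph \<Rightarrow> real" where
  "leakage_rate \<beta> \<Gamma> \<Theta> = lim (\<lambda>t. opt_leakage \<beta> \<Gamma> \<Theta> t / real t)"

(* vertex set and set of hyperedges *)
type_synonym 'v hypergraph = "'v set \<times> 'v set set"

definition assoc_hypergraph :: "'v pair_pre_digraph \<Rightarrow> 'v set \<Rightarrow> 'v hypergraph" where
  "assoc_hypergraph \<Theta> T = (T, {T \<inter> closed_nbhd \<Theta> x | x. x \<in> pverts \<Theta>} - {{}})"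

definition fold_covering :: "'v hypergraph \<Rightarrow> nat \<Rightarrow> 'v set multiset \<Rightarrow> bool" where
  "fold_covering H b M \<longleftrightarrow>
     set_mset M \<subseteq> snd H \<and> (\<forall>v\<in>fst H. b \<le> size {#e \<in># M. v \<in> e#})"

definition fold_covering_number :: "'v hypergraph \<Rightarrow> nat \<Rightarrow> nat" where
  "fold_covering_number H b = (LEAST m. \<exists>M. fold_covering H b M \<and> size M = m)"

definition fractional_covering_number :: "'v hypergraph \<Rightarrow> real" where
  "fractional_covering_number H = (INF b\<in>{1..}. real (fold_covering_number H b) / real b)"

(* The Sup is a maximum: the feasible weightings form a nonempty compact polytope. *)
definition fractional_packing_number :: "'v pair_pre_digraph \<Rightarrow> real" where
  "fractional_packing_number \<Theta> =
     Sup {\<Sum>x\<in>pverts \<Theta>. w x | w :: 'v \<Rightarrow> real.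
            (\<forall>x\<in>pverts \<Theta>. 0 \<le> w x \<and> w x \<le> 1) \<and>
            (\<forall>x\<in>pverts \<Theta>. (\<Sum>x'\<in>closed_nbhd \<Theta> x. w x') \<le> 1)}"

definition fold_colouring :: "'v pair_pre_digraph \<Rightarrow> nat \<Rightarrow> 'v set multiset \<Rightarrow> bool" where
  "fold_colouring G b M \<longleftrightarrow>
     (\<forall>S\<in>#M. indep_set G S) \<and> (\<forall>v\<in>pverts G. size {#S \<in># M. v \<in> S#} = b)"

definition fold_chromatic_number :: "'v pair_pre_digraph \<Rightarrow> nat \<Rightarrow> nat" where
  "fold_chromatic_number G b = (LEAST m. \<exists>M. fold_colouring G b M \<and> size M = m)"

definition fractional_chromatic_number :: "'v pair_pre_digraph \<Rightarrow> real" where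
  "fractional_chromatic_number G = (INF b\<in>{1..}. real (fold_chromatic_number G b) / real b)"

end

theory Submission
  imports Defs
begin

text \<open>Lower bound: take the source distribution proportional to a fractional packing of weight
  \<open>p\<close>. In the strong power every neighbourhood then has mass at most \<open>p\<^sup>-\<^sup>t\<close>, so blind
  guessing succeeds with at most this probability. An independent set of the disjunctive power lies
  in a box of maximal independent sets, and products of fractional covers of the factors cover that
  box; averaging the guesses over such a product shows that seeing the code symbol yields a success
  probability of at least \<open>c\<^sup>-\<^sup>t\<close>, for every \<open>c\<close> above the covering numbers of the single-letter
  hypergraphs. Both estimates are single-letter, so no multiplicativity of the covering numbers of
  the powers is needed.

  Upper bound: encode each letter independently by a uniformly random colour class of a
  \<open>b\<close>-fold colouring with \<open>m\<close> classes. Each of the \<open>m\<^sup>t\<close> codewords has conditional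
  probability at most \<open>b\<^sup>-\<^sup>t\<close>, whence the leakage is at most \<open>t log (m/b)\<close>.\<close>

section \<open>Boxes of words and product sums over them\<close>

text \<open>The sides may vary with the coordinate, so that source words, neighbourhoods in the
  strong power, products of independent sets and sets of codewords are all instances of one
  notion.\<close>

definition list_box :: "nat \<Rightarrow> (nat \<Rightarrow> 'a set) \<Rightarrow> 'a list set" where
  "list_box t S = {xs. length xs = t \<and> (\<forall>j<t. xs ! j \<in> S j)}"

lemma list_box_0: "list_box 0 S = {[]}"
  by (auto simp: list_box_def)

lemma list_box_Suc: "list_box (Suc t) S = (\<lambda>(a, xs). a # xs) ` (S 0 \<times> list_box t (\<lambda>j. S (Suc j)))"
proof (intro set_eqI)
  fix xs
  show "xs \<in> list_box (Suc t) S \<longleftrightarrow> xs \<in> (\<lambda>(a, xs). a # xs) ` (S 0 \<times> list_box t (\<lambda>j. S (Suc j)))"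
    by (cases xs) (auto simp: list_box_def image_iff All_less_Suc2)
qed

text \<open>Distributivity, peeled off one coordinate at a time. The semiring is left general: over
  the naturals the formula counts boxes, over the reals it evaluates probabilities and cover
  weights.\<close>

lemma sum_prod_list_box:
  fixes f :: "nat \<Rightarrow> 'a \<Rightarrow> 'b::comm_semiring_1"
  shows "(\<Sum>xs\<in>list_box t S. \<Prod>j<t. f j (xs ! j)) = (\<Prod>j<t. \<Sum>a\<in>S j. f j a)"
proof (induction t arbitrary: f S)
  case 0
  show ?case by (simp add: list_box_0)
next
  case (Suc t)
  \<comment> \<open>The rule \<open>prod.lessThan_Suc\<close> splits off the last factor, whereas
    the cons decomposition needs the first one.\<close>
  have "(\<Sum>xs\<in>list_box (Suc t) S. \<Prod>j<Suc t. f j (xs ! j)) =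
      (\<Sum>(a, xs)\<in>S 0 \<times> list_box t (\<lambda>j. S (Suc j)). f 0 a * (\<Prod>j<t. f (Suc j) (xs ! j)))"
    unfolding list_box_Suc
    by (subst sum.reindex)
      (auto simp: inj_on_def prod.lessThan_Suc_shift simp del: prod.lessThan_Suc intro!: sum.cong)
  also have "\<dots> = (\<Sum>a\<in>S 0. f 0 a) *
      (\<Sum>xs\<in>list_box t (\<lambda>j. S (Suc j)). \<Prod>j<t. f (Suc j) (xs ! j))"
    by (simp add: sum_product sum.cartesian_product)
  also have "\<dots> = (\<Prod>j<Suc t. \<Sum>a\<in>S j. f j a)"
    by (subst Suc.IH) (simp add: prod.lessThan_Suc_shift del: prod.lessThan_Suc)
  finally show ?case .
qed

lemma finite_list_box: "(\<And>j. j < t \<Longrightarrow> finite (S j)) \<Longrightarrow> finite (list_box t S)"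
proof (induction t arbitrary: S)
  case (Suc t)
  then show ?case unfolding list_box_Suc by (intro finite_imageI finite_cartesian_product) auto
qed (simp add: list_box_0)

lemma card_list_box: "card (list_box t S) = (\<Prod>j<t. card (S j))"
  using sum_prod_list_box[of "\<lambda>_ _. 1::nat" t S] by simp

lemma words_eq_list_box: "words X t = list_box t (\<lambda>_. X)"
  by (auto simp: words_def list_box_def subset_iff in_set_conv_nth)

lemma finite_words: "finite X \<Longrightarrow> finite (words X t)"
  by (simp add: words_eq_list_box finite_list_box)

lemma words_nonempty: "X \<noteq> {} \<Longrightarrow> words X t \<noteq> {}"
  unfolding words_eq_list_box list_box_def
  by (auto intro!: exI[of _ "replicate t (SOME x. x \<in> X)"] simp: some_in_eq)

section \<open>Neighbourhoods in the strong power\<close>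

lemma closed_nbhd_subset: "closed_nbhd G x \<subseteq> pverts G"
  by (auto simp: closed_nbhd_def)

text \<open>The arcs omit the diagonal and the closed neighbourhood restores it, so only the
  coordinatewise condition remains. This makes neighbourhood masses factor over the
  coordinates.\<close>

lemma closed_nbhd_strong_power:
  assumes "x \<in> words (pverts G) t"
  shows "closed_nbhd (strong_power G t) x = list_box t (\<lambda>j. closed_nbhd G (x ! j))"
proof (intro set_eqI)
  fix v
  have "v = x \<longleftrightarrow> length v = t \<and> (\<forall>j<t. v ! j = x ! j)"
    using assms by (auto simp: words_def list_eq_iff_nth_eq)
  then show "v \<in> closed_nbhd (strong_power G t) x \<longleftrightarrow> v \<in> list_box t (\<lambda>j. closed_nbhd G (x ! j))"
    using assms unfolding closed_nbhd_def strong_power_def words_eq_list_box list_box_def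
    by (cases "v = x") (auto simp: eq_commute)
qed

lemma closed_nbhd_strong_power_subset:
  "closed_nbhd (strong_power G t) x \<subseteq> words (pverts G) t"
  by (auto simp: closed_nbhd_def strong_power_def)

lemma word_prob_nonneg: "0 \<le> word_prob P xs"
  by (simp add: word_prob_def prod_nonneg)

lemma sum_word_prob_list_box:
  "(\<Sum>xs\<in>list_box t S. word_prob P xs) = (\<Prod>j<t. \<Sum>a\<in>S j. pmf P a)"
proof -
  have "(\<Sum>xs\<in>list_box t S. word_prob P xs) = (\<Sum>xs\<in>list_box t S. \<Prod>j<t. pmf P (xs ! j))"
    by (intro sum.cong) (auto simp: word_prob_def list_box_def)
  then show ?thesis by (simp add: sum_prod_list_box[of "\<lambda>_. pmf P"])
qed

section \<open>Independent sets of a graph and of its disjunctive powers\<close>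

lemma ex_max_indep_set_superset:
  assumes "finite (pverts G)" "indep_set G S"
  shows "\<exists>T\<in>max_indep_sets G. S \<subseteq> T"
proof -
  have "finite {S. indep_set G S}"
    by (rule finite_subset[of _ "Pow (pverts G)"]) (auto simp: indep_set_def assms)
  from finite_has_maximal2[OF this, of S] assms show ?thesis
    by (auto simp: max_indep_sets_def)
qed

lemma finite_max_indep_sets: "finite (pverts G) \<Longrightarrow> finite (max_indep_sets G)"
  by (rule finite_subset[of _ "Pow (pverts G)"]) (auto simp: max_indep_sets_def indep_set_def)

text \<open>Loop-freeness makes every singleton independent, so the empty set cannot be
  maximal.\<close>

lemma max_indep_set_nonempty:
  assumes "pair_graph G" "pverts G \<noteq> {}" "T \<in> max_indep_sets G"
  shows "T \<noteq> {}"
proof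
  assume T: "T = {}"
  interpret pair_graph G by fact
  obtain v where "v \<in> pverts G" using assms(2) by auto
  then have "indep_set G {v}"
    using pair_no_loops by (force simp: indep_set_def)
  then show False using assms(3) unfolding T max_indep_sets_def by blast
qed

text \<open>An arc in a single coordinate already joins two words, so every coordinate projection of
  \<open>S\<close> is independent. Each projection is then enlarged to a maximal independent
  set.\<close>

lemma indep_set_or_power_subset_list_box:
  assumes "finite (pverts G)" "indep_set (or_power G t) S"
  shows "\<exists>T. (\<forall>j<t. T j \<in> max_indep_sets G) \<and> S \<subseteq> list_box t T"
proof -
  have S: "S \<subseteq> words (pverts G) t"
    using assms(2) by (auto simp: indep_set_def or_power_def)
  have "indep_set G ((\<lambda>x. x ! j) ` S)" if "j < t" for j
    unfolding indep_set_def
  proof (intro conjI ballI notI)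
    show "(\<lambda>x. x ! j) ` S \<subseteq> pverts G"
      using S that by (auto simp: words_eq_list_box list_box_def)
    fix a b assume "a \<in> (\<lambda>x. x ! j) ` S" "b \<in> (\<lambda>x. x ! j) ` S" "(a, b) \<in> parcs G"
    then obtain u v where uv: "u \<in> S" "v \<in> S" "(u ! j, v ! j) \<in> parcs G" by auto
    with S that have "(u, v) \<in> parcs (or_power G t)" by (auto simp: or_power_def)
    with uv assms(2) show False by (auto simp: indep_set_def)
  qed
  then have "\<forall>j\<in>{..<t}. \<exists>T\<in>max_indep_sets G. (\<lambda>x. x ! j) ` S \<subseteq> T"
    using ex_max_indep_set_superset[OF assms(1)] by auto
  then obtain T where "\<forall>j\<in>{..<t}. T j \<in> max_indep_sets G \<and> (\<lambda>x. x ! j) ` S \<subseteq> T j"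
    by (metis (no_types))
  then show ?thesis using S
    by (intro exI[of _ T]) (auto simp: words_eq_list_box list_box_def)
qed

text \<open>An arc between two words of the box would be an arc inside some side \<open>T j\<close>.
  This gives validity of the letterwise code.\<close>

lemma indep_set_or_power_list_box:
  assumes "\<And>j. j < t \<Longrightarrow> indep_set G (T j)"
  shows "indep_set (or_power G t) (list_box t T)"
proof -
  have "T j \<subseteq> pverts G" if "j < t" for j
    using assms[OF that] by (simp add: indep_set_def)
  then have "list_box t T \<subseteq> words (pverts G) t"
    unfolding words_eq_list_box list_box_def by blast
  then show ?thesis
    using assms by (auto simp: indep_set_def or_power_def list_box_def)
qed

lemma indep_set_subset: "indep_set G T \<Longrightarrow> S \<subseteq> T \<Longrightarrow> indep_set G S"
  by (auto simp: indep_set_def)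

section \<open>Success mass of the best guess\<close>

text \<open>The mass \<open>g\<close> need not be normalised: the source distribution gives the
  denominator of the leakage quotient, and its product with the probability of a symbol gives one
  summand of the numerator.\<close>

definition guess_mass :: "'a pair_pre_digraph \<Rightarrow> nat \<Rightarrow> ('a list \<Rightarrow> real) \<Rightarrow> real" where
  "guess_mass G t g =
     (MAX x\<in>words (pverts G) t. \<Sum>x'\<in>closed_nbhd (strong_power G t) x. g x')"

lemma guess_mass_ge:
  assumes "finite (pverts G)" "x \<in> words (pverts G) t"
  shows "(\<Sum>x'\<in>closed_nbhd (strong_power G t) x. g x') \<le> guess_mass G t g"
  unfolding guess_mass_def using assms by (intro Max_ge) (auto simp: finite_words)

lemma guess_mass_le:
  assumes "finite (pverts G)" "pverts G \<noteq> {}"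
    and "\<And>x. x \<in> words (pverts G) t \<Longrightarrow> (\<Sum>x'\<in>closed_nbhd (strong_power G t) x. g x') \<le> c"
  shows "guess_mass G t g \<le> c"
  unfolding guess_mass_def using assms by (intro Max.boundedI) (auto simp: finite_words words_nonempty)

lemma guess_mass_nonneg:
  assumes "finite (pverts G)" "pverts G \<noteq> {}"
    and "\<And>x. x \<in> words (pverts G) t \<Longrightarrow> 0 \<le> g x"
  shows "0 \<le> guess_mass G t g"
proof -
  obtain x where x: "x \<in> words (pverts G) t" using words_nonempty[OF assms(2)] by auto
  have "0 \<le> (\<Sum>x'\<in>closed_nbhd (strong_power G t) x. g x')"
    using closed_nbhd_strong_power_subset[of G t x] assms(3) by (intro sum_nonneg) auto
  also have "\<dots> \<le> guess_mass G t g" by (intro guess_mass_ge assms x)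
  finally show ?thesis .
qed

lemma guess_mass_le_mult:
  assumes fin: "finite (pverts G)" "pverts G \<noteq> {}" and "0 \<le> q"
    and le: "\<And>x. x \<in> words (pverts G) t \<Longrightarrow> g x \<le> q * h x"
  shows "guess_mass G t g \<le> q * guess_mass G t h"
proof (intro guess_mass_le fin)
  fix x assume x: "x \<in> words (pverts G) t"
  have "(\<Sum>x'\<in>closed_nbhd (strong_power G t) x. g x') \<le>
      (\<Sum>x'\<in>closed_nbhd (strong_power G t) x. q * h x')"
    using closed_nbhd_strong_power_subset[of G t x] le by (intro sum_mono) auto
  also have "\<dots> = q * (\<Sum>x'\<in>closed_nbhd (strong_power G t) x. h x')"
    by (simp add: sum_distrib_left)
  also have "\<dots> \<le> q * guess_mass G t h"
    by (intro mult_left_mono guess_mass_ge fin x \<open>0 \<le> q\<close>)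
  finally show "(\<Sum>x'\<in>closed_nbhd (strong_power G t) x. g x') \<le> q * guess_mass G t h" .
qed

definition guess_quotient ::
    "'a pair_pre_digraph \<Rightarrow> nat \<Rightarrow> nat set \<Rightarrow> ('a list \<Rightarrow> nat pmf) \<Rightarrow> 'a pmf \<Rightarrow> real" where
  "guess_quotient G t Y K P =
     (\<Sum>y\<in>Y. guess_mass G t (\<lambda>x. word_prob P x * pmf (K x) y)) / guess_mass G t (word_prob P)"

lemma approx_leakage_eq:
  "approx_leakage \<beta> G t Y K = log \<beta> (SUP P\<in>{P. set_pmf P \<subseteq> pverts G}. guess_quotient G t Y K P)"
  unfolding approx_leakage_def guess_quotient_def guess_mass_def ..

text \<open>Each summand of the numerator is at most \<open>q\<close> times the denominator,
  uniformly in \<open>P\<close>. The bound serves twice: for the code built from a colouring, and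
  with \<open>q = 1\<close> to make the supremum over \<open>P\<close> bounded.\<close>

lemma guess_quotient_le:
  assumes fin: "finite (pverts G)" "pverts G \<noteq> {}" and "0 \<le> q"
    and le: "\<And>x y. x \<in> words (pverts G) t \<Longrightarrow> y \<in> Y \<Longrightarrow> pmf (K x) y \<le> q"
  shows "guess_quotient G t Y K P \<le> real (card Y) * q"
proof -
  have "(\<Sum>y\<in>Y. guess_mass G t (\<lambda>x. word_prob P x * pmf (K x) y)) \<le>
      (\<Sum>y\<in>Y. q * guess_mass G t (word_prob P))"
    using le
    by (intro sum_mono guess_mass_le_mult fin \<open>0 \<le> q\<close>)
      (metis mult.commute mult_left_mono word_prob_nonneg)
  also have "\<dots> = real (card Y) * q * guess_mass G t (word_prob P)" by simp
  finally have "(\<Sum>y\<in>Y. guess_mass G t (\<lambda>x. word_prob P x * pmf (K x) y)) \<le>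
      real (card Y) * q * guess_mass G t (word_prob P)" .
  moreover have "0 \<le> guess_mass G t (word_prob P)"
    by (intro guess_mass_nonneg fin word_prob_nonneg)
  \<comment> \<open>A vanishing denominator makes the quotient 0 by convention, which the
    nonnegative bound dominates.\<close>
  ultimately show ?thesis
    unfolding guess_quotient_def using \<open>0 \<le> q\<close>
    by (cases "guess_mass G t (word_prob P) = 0") (auto simp: pos_divide_le_eq)
qed

lemma guess_quotient_bdd_above:
  assumes "finite (pverts G)" "pverts G \<noteq> {}"
  shows "bdd_above (guess_quotient G t Y K ` A)"
  using guess_quotient_le[OF assms, of 1 t Y K]
  by (intro bdd_aboveI2[of _ _ "real (card Y) * 1"]) (auto simp: pmf_le_1)

text \<open>The product of fractional covers of the coordinate sets is a fractional cover of the box;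
  averaging the guesses against it bounds the total mass.\<close>

lemma sum_le_guess_mass:
  assumes fin: "finite (pverts G)"
    and nonneg: "\<And>x. x \<in> words (pverts G) t \<Longrightarrow> 0 \<le> g x"
    and supp: "\<And>x. x \<in> words (pverts G) t \<Longrightarrow> g x \<noteq> 0 \<Longrightarrow> x \<in> list_box t T"
    and w_nonneg: "\<And>j a. j < t \<Longrightarrow> 0 \<le> w j a"
    and w_sum: "\<And>j. j < t \<Longrightarrow> (\<Sum>a\<in>pverts G. w j a) \<le> c"
    and w_cover: "\<And>j v. j < t \<Longrightarrow> v \<in> T j \<Longrightarrow> 1 \<le> (\<Sum>a | a \<in> pverts G \<and> v \<in> closed_nbhd G a. w j a)"
    and "pverts G \<noteq> {}"
  shows "(\<Sum>x\<in>words (pverts G) t. g x) \<le> c ^ t * guess_mass G t g"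
proof -
  let ?V = "words (pverts G) t" and ?N = "closed_nbhd (strong_power G t)"
  define W where "W x = (\<Prod>j<t. w j (x ! j))" for x
  have finV: "finite ?V" by (rule finite_words[OF fin])
  have W_nonneg: "0 \<le> W x" for x unfolding W_def using w_nonneg by (intro prod_nonneg) auto
  \<comment> \<open>The guesses that reach \<open>v\<close> form a box, so their total weight is a
    product of coordinate sums, each at least 1.\<close>
  have cover: "1 \<le> (\<Sum>x | x \<in> ?V \<and> v \<in> ?N x. W x)" if v: "v \<in> ?V" "v \<in> list_box t T" for v
  proof -
    have "{x. x \<in> ?V \<and> v \<in> ?N x} = list_box t (\<lambda>j. {a. a \<in> pverts G \<and> v ! j \<in> closed_nbhd G a})"
    proof -
      have "{x. x \<in> ?V \<and> v \<in> ?N x} = {x \<in> ?V. v \<in> list_box t (\<lambda>j. closed_nbhd G (x ! j))}"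
        using closed_nbhd_strong_power by blast
      then show ?thesis using v(1) by (auto simp: words_eq_list_box list_box_def)
    qed
    then have "(\<Sum>x | x \<in> ?V \<and> v \<in> ?N x. W x) =
        (\<Prod>j<t. \<Sum>a | a \<in> pverts G \<and> v ! j \<in> closed_nbhd G a. w j a)"
      by (simp add: W_def sum_prod_list_box[of w])
    also have "\<dots> \<ge> 1" using v(2) by (intro prod_ge_1 w_cover) (auto simp: list_box_def)
    finally show ?thesis .
  qed
  have "(\<Sum>v\<in>?V. g v) \<le> (\<Sum>v\<in>?V. g v * (\<Sum>x | x \<in> ?V \<and> v \<in> ?N x. W x))"
  proof (intro sum_mono)
    fix v assume v: "v \<in> ?V"
    show "g v \<le> g v * (\<Sum>x | x \<in> ?V \<and> v \<in> ?N x. W x)"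
    proof (cases "g v = 0")
      case False
      then have "g v * 1 \<le> g v * (\<Sum>x | x \<in> ?V \<and> v \<in> ?N x. W x)"
        using v supp nonneg by (intro mult_left_mono cover) auto
      then show ?thesis by simp
    qed simp
  qed
  also have "\<dots> = (\<Sum>v\<in>?V. \<Sum>x | x \<in> ?V \<and> v \<in> ?N x. g v * W x)"
    by (simp add: sum_distrib_left)
  \<comment> \<open>Double counting: cover weights seen from the words \<open>v\<close> become
    weights on the guesses \<open>x\<close>.\<close>
  also have "\<dots> = (\<Sum>x\<in>?V. \<Sum>v | v \<in> ?V \<and> v \<in> ?N x. g v * W x)"
    by (rule sum.swap_restrict) (auto simp: finV)
  also have "\<dots> = (\<Sum>x\<in>?V. W x * (\<Sum>v\<in>?N x. g v))"
  proof (intro sum.cong refl)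
    fix x
    have "{v. v \<in> ?V \<and> v \<in> ?N x} = ?N x" using closed_nbhd_strong_power_subset[of G t x] by auto
    then show "(\<Sum>v | v \<in> ?V \<and> v \<in> ?N x. g v * W x) = W x * (\<Sum>v\<in>?N x. g v)"
      by (simp add: sum_distrib_left mult.commute)
  qed
  also have "\<dots> \<le> (\<Sum>x\<in>?V. W x * guess_mass G t g)"
    by (intro sum_mono mult_left_mono guess_mass_ge W_nonneg fin)
  also have "\<dots> = (\<Prod>j<t. \<Sum>a\<in>pverts G. w j a) * guess_mass G t g"
    by (simp add: W_def words_eq_list_box sum_prod_list_box[of w] flip: sum_distrib_right)
  also have "\<dots> \<le> c ^ t * guess_mass G t g"
  proof (intro mult_right_mono)
    have "(\<Prod>j<t. \<Sum>a\<in>pverts G. w j a) \<le> (\<Prod>j<t. c)"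
      using w_nonneg w_sum by (intro prod_mono conjI sum_nonneg) auto
    then show "(\<Prod>j<t. \<Sum>a\<in>pverts G. w j a) \<le> c ^ t" by simp
    show "0 \<le> guess_mass G t g" using assms by (intro guess_mass_nonneg) auto
  qed
  finally show ?thesis .
qed

lemma ex_pmf_proportional:
  fixes f :: "'a \<Rightarrow> real"
  assumes "finite V" "\<And>x. x \<in> V \<Longrightarrow> 0 \<le> f x" "0 < (\<Sum>x\<in>V. f x)"
  shows "\<exists>P. set_pmf P \<subseteq> V \<and> (\<forall>x\<in>V. pmf P x = f x / (\<Sum>x\<in>V. f x))"
proof -
  define g where "g x = (if x \<in> V then f x / (\<Sum>x\<in>V. f x) else 0)" for x
  have nonneg: "0 \<le> g x" for x using assms by (auto simp: g_def)
  have "(\<integral>\<^sup>+x. ennreal (g x) \<partial>count_space UNIV) = (\<Sum>x\<in>V. ennreal (g x))"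
    by (rule nn_integral_count_space') (auto simp: assms g_def)
  also have "\<dots> = ennreal (\<Sum>x\<in>V. g x)" by (rule sum_ennreal) (simp add: nonneg)
  also have "(\<Sum>x\<in>V. g x) = 1" using assms(3) by (simp add: g_def flip: sum_divide_distrib)
  finally have int: "(\<integral>\<^sup>+x. ennreal (g x) \<partial>count_space UNIV) = 1" by simp
  show ?thesis
    using pmf_embed_pmf[of g, OF nonneg int] set_embed_pmf[of g, OF nonneg int]
    by (intro exI[of _ "embed_pmf g"]) (auto simp: g_def split: if_splits)
qed

section \<open>From multiple coverings to fractional cover weights\<close>

lemma size_filter_mset_sum:
  assumes "finite V" "set_mset M \<subseteq> V"
  shows "size {#x \<in># M. Q x#} = (\<Sum>x | x \<in> V \<and> Q x. count M x)"
proof -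
  have "size {#x \<in># M. Q x#} = (\<Sum>x\<in>V. count {#x \<in># M. Q x#} x)"
    unfolding size_multiset_overloaded_eq
    by (rule sum.mono_neutral_left) (use assms in \<open>auto simp: not_in_iff\<close>)
  also have "\<dots> = (\<Sum>x\<in>V. if Q x then count M x else 0)" by simp
  finally show ?thesis using assms(1) by (simp add: sum.If_cases Int_def)
qed

text \<open>Take \<open>b\<close> copies of every hyperedge: a vertex lies in the hyperedge cut out
  by its own neighbourhood. Existence makes the least cardinality an attained value.\<close>

lemma ex_fold_covering:
  assumes "finite (pverts G)" "T \<subseteq> pverts G"
  shows "\<exists>M. fold_covering (assoc_hypergraph G T) b M"
proof (intro exI[of _ "repeat_mset b (mset_set ((\<lambda>x. T \<inter> closed_nbhd G x) ` pverts G - {{}}))"])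
  let ?E = "(\<lambda>x. T \<inter> closed_nbhd G x) ` pverts G - {{}}"
  let ?M = "repeat_mset b (mset_set ?E)"
  have fin: "finite ?E" using assms(1) by simp
  have "b \<le> size {#e \<in># ?M. v \<in> e#}" if "v \<in> T" for v
  proof -
    let ?e = "T \<inter> closed_nbhd G v"
    have v: "v \<in> ?e" "?e \<in> ?E" using that assms(2) by (auto simp: closed_nbhd_def)
    then have "replicate_mset b ?e \<subseteq># {#e \<in># ?M. v \<in> e#}"
      using fin by (simp flip: count_le_replicate_mset_subset_eq)
    from size_mset_mono[OF this] show ?thesis by simp
  qed
  moreover have "set_mset ?M \<subseteq> ?E"
    using fin by (metis (no_types, lifting) count_repeat_mset finite_set_mset_mset_set
        mult_0_right not_in_iff subsetI)
  ultimately show "fold_covering (assoc_hypergraph G T) b ?M"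
    by (auto simp: fold_covering_def assoc_hypergraph_def)
qed

lemma fold_covering_number_attained:
  assumes "finite (pverts G)" "T \<subseteq> pverts G"
  shows "\<exists>M. fold_covering (assoc_hypergraph G T) b M \<and>
    size M = fold_covering_number (assoc_hypergraph G T) b"
  unfolding fold_covering_number_def
  using LeastI_ex[of "\<lambda>m. \<exists>M. fold_covering (assoc_hypergraph G T) b M \<and> size M = m"]
    ex_fold_covering[OF assms, of b] by blast

text \<open>A single vertex already forces at least \<open>b\<close> hyperedges in any
  \<open>b\<close>-fold covering.\<close>

lemma fractional_covering_number_ge_1:
  assumes "finite (pverts G)" "T \<subseteq> pverts G" "T \<noteq> {}"
  shows "1 \<le> fractional_covering_number (assoc_hypergraph G T)"
  unfolding fractional_covering_number_def
proof (rule cINF_greatest)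
  fix b :: nat assume b: "b \<in> {1..}"
  obtain M where M: "fold_covering (assoc_hypergraph G T) b M"
    "size M = fold_covering_number (assoc_hypergraph G T) b"
    using fold_covering_number_attained[OF assms(1,2)] by blast
  obtain v where "v \<in> T" using assms(3) by auto
  with M(1) have "b \<le> size {#e \<in># M. v \<in> e#}"
    by (simp add: fold_covering_def assoc_hypergraph_def)
  also have "\<dots> \<le> size M" by (simp add: size_mset_mono)
  finally show "1 \<le> real (fold_covering_number (assoc_hypergraph G T) b) / real b"
    using b M(2) by (simp add: le_divide_eq)
qed simp

text \<open>Every hyperedge of the covering is charged to one centre whose neighbourhood cuts it out
  of \<open>T\<close>. The weight of a letter is the number of hyperedges charged to it, with
  multiplicity, divided by \<open>b\<close>.\<close>

lemma fold_covering_weights: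
  assumes fin: "finite (pverts G)" and M: "fold_covering (assoc_hypergraph G T) b M" and "0 < b"
  shows "\<exists>w. (\<forall>x. 0 \<le> w x) \<and> (\<Sum>x\<in>pverts G. w x) = real (size M) / real b \<and>
    (\<forall>v\<in>T. 1 \<le> (\<Sum>x | x \<in> pverts G \<and> v \<in> closed_nbhd G x. w x))"
proof -
  have "\<exists>x\<in>pverts G. T \<inter> closed_nbhd G x = e" if "e \<in># M" for e
  proof -
    have "set_mset M \<subseteq> snd (assoc_hypergraph G T)"
      using M unfolding fold_covering_def by (rule conjunct1)
    with that have "e \<in> snd (assoc_hypergraph G T)" by (rule subsetD[rotated])
    then show ?thesis unfolding assoc_hypergraph_def by auto
  qed
  then obtain ctr where ctr: "\<And>e. e \<in># M \<Longrightarrow> ctr e \<in> pverts G"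
    "\<And>e. e \<in># M \<Longrightarrow> T \<inter> closed_nbhd G (ctr e) = e"
    by metis
  let ?C = "image_mset ctr M"
  have C: "set_mset ?C \<subseteq> pverts G" using ctr(1) by auto
  define w where "w x = real (count ?C x) / real b" for x
  have "(\<Sum>x\<in>pverts G. count ?C x) = size M"
    using size_filter_mset_sum[OF fin C, of "\<lambda>_. True"] by simp
  then have "(\<Sum>x\<in>pverts G. w x) = real (size M) / real b"
    unfolding w_def sum_divide_distrib[symmetric] by (metis of_nat_sum)
  moreover have "1 \<le> (\<Sum>x | x \<in> pverts G \<and> v \<in> closed_nbhd G x. w x)" if v: "v \<in> T" for v
  proof -
    have "b \<le> size {#e \<in># M. v \<in> e#}"
      using M v by (simp add: fold_covering_def assoc_hypergraph_def)
    also have "{#e \<in># M. v \<in> e#} = {#e \<in># M. v \<in> closed_nbhd G (ctr e)#}"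
      using ctr(2) v by (intro filter_mset_cong) auto
    also have "size \<dots> = size {#x \<in># ?C. v \<in> closed_nbhd G x#}"
      by (simp add: filter_mset_image_mset)
    also have "\<dots> = (\<Sum>x | x \<in> pverts G \<and> v \<in> closed_nbhd G x. count ?C x)"
      by (rule size_filter_mset_sum[OF fin C])
    finally have "real b \<le> (\<Sum>x | x \<in> pverts G \<and> v \<in> closed_nbhd G x. real (count ?C x))"
      by (metis of_nat_le_iff of_nat_sum)
    then show ?thesis using \<open>0 < b\<close>
      by (simp add: w_def le_divide_eq flip: sum_divide_distrib)
  qed
  moreover have "0 \<le> w x" for x by (simp add: w_def)
  ultimately show ?thesis by blast
qed

text \<open>Strictly above the infimum some actual \<open>b\<close>-fold covering has ratio below
  \<open>c\<close>. The slack between \<open>c\<close> and the infimum disappears only in the final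
  theorem.\<close>

lemma fractional_cover_weights:
  assumes "finite (pverts G)" "T \<subseteq> pverts G"
    and "fractional_covering_number (assoc_hypergraph G T) < c"
  shows "\<exists>w. (\<forall>x. 0 \<le> w x) \<and> (\<Sum>x\<in>pverts G. w x) \<le> c \<and>
    (\<forall>v\<in>T. 1 \<le> (\<Sum>x | x \<in> pverts G \<and> v \<in> closed_nbhd G x. w x))"
proof -
  obtain b :: nat where b: "1 \<le> b" "real (fold_covering_number (assoc_hypergraph G T) b) / real b < c"
    using cInf_lessD[OF _ assms(3)[unfolded fractional_covering_number_def]] by auto
  obtain M where M: "fold_covering (assoc_hypergraph G T) b M"
    "size M = fold_covering_number (assoc_hypergraph G T) b"
    using fold_covering_number_attained[OF assms(1,2)] by blast
  from b(1) have "0 < b" by simp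
  from fold_covering_weights[OF assms(1) M(1) this] b(2) show ?thesis
    unfolding M(2) by (metis less_imp_le)
qed

section \<open>Lower bound for an arbitrary valid mapping\<close>

text \<open>With \<open>p\<close> the total weight of \<open>f\<close>, the denominator is at most
  \<open>(1 / p) ^ t\<close> and the numerator at least \<open>1 / c ^ t\<close>. The distribution
  \<open>P\<close> depends on \<open>f\<close> alone, while the covers are chosen afresh for each
  symbol and coordinate.\<close>

lemma guess_quotient_ge:
  assumes fin: "finite (pverts \<Theta>)" and ne: "pverts \<Theta> \<noteq> {}" and eq: "pverts \<Theta> = pverts \<Gamma>"
    and valid: "valid_mapping \<Gamma> t Y K"
    and f_nonneg: "\<And>x. x \<in> pverts \<Theta> \<Longrightarrow> 0 \<le> f x"
    and f_le: "\<And>x. x \<in> pverts \<Theta> \<Longrightarrow> (\<Sum>x'\<in>closed_nbhd \<Theta> x. f x') \<le> 1"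
    and f_pos: "0 < (\<Sum>x\<in>pverts \<Theta>. f x)"
    and c_pos: "0 < c"
    and c: "\<And>T. T \<in> max_indep_sets \<Gamma> \<Longrightarrow> fractional_covering_number (assoc_hypergraph \<Theta> T) < c"
  shows "\<exists>P. set_pmf P \<subseteq> pverts \<Theta> \<and>
    ((\<Sum>x\<in>pverts \<Theta>. f x) / c) ^ t \<le> guess_quotient \<Theta> t Y K P"
proof -
  let ?V = "words (pverts \<Theta>) t" and ?N = "closed_nbhd (strong_power \<Theta> t)"
  define p where "p = (\<Sum>x\<in>pverts \<Theta>. f x)"
  have p: "0 < p" using f_pos by (simp add: p_def)
  obtain P where P: "set_pmf P \<subseteq> pverts \<Theta>" "\<And>x. x \<in> pverts \<Theta> \<Longrightarrow> pmf P x = f x / p"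
    using ex_pmf_proportional[OF fin f_nonneg f_pos] unfolding p_def by blast
  let ?D = "guess_mass \<Theta> t (word_prob P)"
  have finV: "finite ?V" by (rule finite_words[OF fin])
  have total: "(\<Sum>x\<in>?V. word_prob P x) = 1"
    using sum_pmf_eq_1[OF fin P(1)] by (simp add: words_eq_list_box sum_word_prob_list_box)
  \<comment> \<open>The packing constraint, scaled by \<open>p\<close>, bounds the neighbourhood
    mass in each coordinate by \<open>1 / p\<close>.\<close>
  have D_le: "?D \<le> (1 / p) ^ t"
  proof (intro guess_mass_le fin ne)
    fix x assume x: "x \<in> ?V"
    then have x_nth: "x ! j \<in> pverts \<Theta>" if "j < t" for j
      using that by (simp add: words_eq_list_box list_box_def)
    have "(\<Sum>x'\<in>?N x. word_prob P x') = (\<Prod>j<t. \<Sum>a\<in>closed_nbhd \<Theta> (x ! j). pmf P a)"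
      by (simp add: closed_nbhd_strong_power[OF x] sum_word_prob_list_box)
    also have "\<dots> \<le> (\<Prod>j<t. 1 / p)"
    proof (intro prod_mono conjI sum_nonneg pmf_nonneg)
      fix j assume "j \<in> {..<t}"
      then have j: "x ! j \<in> pverts \<Theta>" using x_nth by simp
      have "(\<Sum>a\<in>closed_nbhd \<Theta> (x ! j). pmf P a) = (\<Sum>a\<in>closed_nbhd \<Theta> (x ! j). f a) / p"
        unfolding sum_divide_distrib
        using P(2) closed_nbhd_subset[of \<Theta> "x ! j"] by (intro sum.cong refl) auto
      also have "\<dots> \<le> 1 / p" using f_le[OF j] p by (simp add: divide_right_mono)
      finally show "(\<Sum>a\<in>closed_nbhd \<Theta> (x ! j). pmf P a) \<le> 1 / p" .
    qed
    finally show "(\<Sum>x'\<in>?N x. word_prob P x') \<le> (1 / p) ^ t" by simp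
  qed
  \<comment> \<open>Positivity of the denominator: each word lies in its own neighbourhood, so
    \<open>?D\<close> bounds every word probability, and these sum to 1.\<close>
  have "word_prob P x \<le> ?D" if x: "x \<in> ?V" for x
  proof -
    have "x \<in> ?N x" using x by (simp add: closed_nbhd_def strong_power_def)
    then have "word_prob P x \<le> (\<Sum>x'\<in>?N x. word_prob P x')"
      using finite_subset[OF closed_nbhd_strong_power_subset finV]
      by (intro member_le_sum word_prob_nonneg) auto
    also have "\<dots> \<le> ?D" by (rule guess_mass_ge[OF fin x])
    finally show ?thesis .
  qed
  then have "1 \<le> real (card ?V) * ?D"
    using sum_bounded_above[of ?V "word_prob P" ?D] unfolding total by simp
  then have D_pos: "0 < ?D"
    using mult_nonneg_nonpos[of "real (card ?V)" ?D] by linarith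
  define g where "g y x = word_prob P x * pmf (K x) y" for y x
  have "(\<Sum>x\<in>?V. g y x) \<le> c ^ t * guess_mass \<Theta> t (g y)" if y: "y \<in> Y" for y
  proof -
    have "indep_set (or_power \<Gamma> t) {x \<in> words (pverts \<Gamma>) t. 0 < pmf (K x) y}"
      using valid y by (simp add: valid_mapping_def)
    from indep_set_or_power_subset_list_box[OF _ this] fin eq
    obtain T where T: "\<And>j. j < t \<Longrightarrow> T j \<in> max_indep_sets \<Gamma>"
      "{x \<in> words (pverts \<Gamma>) t. 0 < pmf (K x) y} \<subseteq> list_box t T" by auto
    have "\<exists>w. (\<forall>x. 0 \<le> w x) \<and> (\<Sum>x\<in>pverts \<Theta>. w x) \<le> c \<and>
        (\<forall>v\<in>T j. 1 \<le> (\<Sum>x | x \<in> pverts \<Theta> \<and> v \<in> closed_nbhd \<Theta> x. w x))" if "j < t" for j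
      using T(1)[OF that] c eq
      by (intro fractional_cover_weights fin) (auto simp: max_indep_sets_def indep_set_def)
    then obtain w where w: "\<And>j. j < t \<Longrightarrow> (\<forall>x. 0 \<le> w j x) \<and> (\<Sum>x\<in>pverts \<Theta>. w j x) \<le> c \<and>
        (\<forall>v\<in>T j. 1 \<le> (\<Sum>x | x \<in> pverts \<Theta> \<and> v \<in> closed_nbhd \<Theta> x. w j x))"
      by metis
    show ?thesis
    proof (rule sum_le_guess_mass[where w = w and T = T])
      fix x assume "x \<in> ?V" "g y x \<noteq> 0"
      then show "x \<in> list_box t T"
        using T(2) eq by (auto simp: g_def pmf_pos)
    qed (use fin ne w in \<open>auto simp: g_def word_prob_nonneg\<close>)
  qed
  then have "(\<Sum>y\<in>Y. \<Sum>x\<in>?V. g y x) \<le> c ^ t * (\<Sum>y\<in>Y. guess_mass \<Theta> t (g y))"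
    unfolding sum_distrib_left by (intro sum_mono)
  moreover have "(\<Sum>y\<in>Y. \<Sum>x\<in>?V. g y x) = 1"
  proof -
    have "(\<Sum>y\<in>Y. \<Sum>x\<in>?V. g y x) = (\<Sum>x\<in>?V. word_prob P x * (\<Sum>y\<in>Y. pmf (K x) y))"
      by (subst sum.swap) (simp add: g_def sum_distrib_left)
    also have "\<dots> = (\<Sum>x\<in>?V. word_prob P x)"
      using valid eq by (intro sum.cong refl) (simp add: valid_mapping_def sum_pmf_eq_1)
    finally show ?thesis using total by simp
  qed
  ultimately have num: "1 / c ^ t \<le> (\<Sum>y\<in>Y. guess_mass \<Theta> t (g y))"
    using c_pos by (simp add: pos_divide_le_eq mult.commute)
  have "(p / c) ^ t = (1 / c ^ t) / (1 / p) ^ t"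
    by (simp add: power_divide)
  also have "\<dots> \<le> (\<Sum>y\<in>Y. guess_mass \<Theta> t (g y)) / ?D"
    using num D_le D_pos c_pos
    by (intro frac_le) (auto intro: order.trans[OF _ num])
  finally show ?thesis
    using P(1) unfolding guess_quotient_def g_def p_def by blast
qed

section \<open>The code obtained from a multiple colouring\<close>

text \<open>Counting positions rather than sets keeps repeated colour classes apart; the positions
  become the letters of the codewords.\<close>

lemma size_filter_mset_eq_card_nth:
  "size {#x \<in># mset xs. Q x#} = card {i. i < length xs \<and> Q (xs ! i)}"
  by (simp add: length_filter_conv_card flip: mset_filter)

text \<open>A word is sent to a uniformly chosen string of class indices whose classes contain its
  letters. There are exactly \<open>b ^ t\<close> such strings, and the words using a given string
  lie in the box of its classes, which is independent.\<close>

lemma ex_valid_mapping_of_colouring: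
  assumes fin: "finite (pverts G)" and M: "fold_colouring G b M" and b: "0 < b"
  shows "\<exists>Y K. valid_mapping G t Y K \<and> card Y = size M ^ t \<and>
    (\<forall>x\<in>words (pverts G) t. \<forall>y\<in>Y. pmf (K x) y \<le> 1 / real b ^ t)"
proof -
  obtain cs where cs: "mset cs = M" using ex_mset by blast
  define S where "S x = list_box t (\<lambda>j. {i. i < length cs \<and> x ! j \<in> cs ! i})" for x
  \<comment> \<open>Index strings are encoded injectively because code alphabets consist of
    naturals.\<close>
  define code :: "nat list \<Rightarrow> nat" where "code = to_nat"
  have inj: "inj_on code A" for A by (simp add: code_def)
  let ?U = "words {..<length cs} t"
  define Y where "Y = code ` ?U"
  define K where "K x = pmf_of_set (code ` S x)" for x
  have S_sub: "S x \<subseteq> ?U" for x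
    by (auto simp: S_def words_eq_list_box list_box_def)
  have finU: "finite ?U" by (simp add: finite_words)
  have finS: "finite (S x)" for x using finite_subset[OF S_sub finU] .
  have cardS: "card (S x) = b ^ t" if "x \<in> words (pverts G) t" for x
  proof -
    have "card {i. i < length cs \<and> x ! j \<in> cs ! i} = b" if "j < t" for j
    proof -
      have "x ! j \<in> pverts G"
        using \<open>x \<in> words (pverts G) t\<close> that by (simp add: words_eq_list_box list_box_def)
      then show ?thesis
        using M by (simp add: fold_colouring_def flip: cs size_filter_mset_eq_card_nth)
    qed
    then show ?thesis by (simp add: S_def card_list_box)
  qed
  have S_ne: "S x \<noteq> {}" if "x \<in> words (pverts G) t" for x
    using cardS[OF that] b by auto
  have pmf_K: "pmf (K x) y = indicator (code ` S x) y / real b ^ t"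
    if "x \<in> words (pverts G) t" for x y
    using S_ne[OF that] finS cardS[OF that] by (simp add: K_def card_image[OF inj])
  have "indep_set (or_power G t) {x \<in> words (pverts G) t. 0 < pmf (K x) y}" if "y \<in> Y" for y
  proof -
    obtain u where u: "u \<in> ?U" "y = code u" using \<open>y \<in> Y\<close> by (auto simp: Y_def)
    have "indep_set (or_power G t) (list_box t (\<lambda>j. cs ! (u ! j)))"
    proof (rule indep_set_or_power_list_box)
      fix j assume "j < t"
      then have "cs ! (u ! j) \<in># M"
        using u(1) by (auto simp: words_eq_list_box list_box_def simp flip: cs)
      then show "indep_set G (cs ! (u ! j))" using M by (simp add: fold_colouring_def)
    qed
    moreover have "{x \<in> words (pverts G) t. 0 < pmf (K x) y} \<subseteq> list_box t (\<lambda>j. cs ! (u ! j))"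
    proof
      fix x assume x: "x \<in> {x \<in> words (pverts G) t. 0 < pmf (K x) y}"
      then have "y \<in> code ` S x" by (cases "y \<in> code ` S x") (auto simp: pmf_K)
      then have "u \<in> S x" using inj[of UNIV] by (auto simp: u(2) dest: injD)
      then show "x \<in> list_box t (\<lambda>j. cs ! (u ! j))"
        using x by (auto simp: S_def words_eq_list_box list_box_def)
    qed
    ultimately show ?thesis by (rule indep_set_subset)
  qed
  moreover have "set_pmf (K x) \<subseteq> Y" if "x \<in> words (pverts G) t" for x
    using S_ne[OF that] finS S_sub[of x] by (auto simp: K_def Y_def)
  moreover have "finite Y" by (simp add: Y_def finU)
  ultimately have "valid_mapping G t Y K" by (simp add: valid_mapping_def)
  moreover have "card Y = size M ^ t"
    by (simp add: Y_def card_image[OF inj] words_eq_list_box card_list_box flip: cs)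
  moreover have "pmf (K x) y \<le> 1 / real b ^ t" if "x \<in> words (pverts G) t" for x y
    by (simp add: pmf_K[OF that] indicator_def)
  ultimately show ?thesis by blast
qed

text \<open>Take \<open>b\<close> copies of every singleton, which is independent because there are
  no loops.\<close>

lemma ex_fold_colouring:
  assumes "pair_graph G"
  shows "\<exists>M. fold_colouring G b M"
proof -
  interpret pair_graph G by fact
  let ?E = "(\<lambda>v. {v}) ` pverts G"
  let ?M = "repeat_mset b (mset_set ?E)"
  have fin: "finite ?E" using pair_finite_verts by simp
  have "size {#S \<in># ?M. v \<in> S#} = b" if v: "v \<in> pverts G" for v
  proof -
    have "{#S \<in># ?M. v \<in> S#} = replicate_mset b {v}"
    proof (rule multiset_eqI)
      fix A
      show "count {#S \<in># ?M. v \<in> S#} A = count (replicate_mset b {v}) A"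
        using v fin by (cases "A \<in> ?E") auto
    qed
    then show ?thesis by simp
  qed
  moreover have "indep_set G S" if "S \<in># ?M" for S
  proof -
    have "S \<in> ?E"
    proof (rule ccontr)
      assume "S \<notin> ?E"
      then have "S \<notin># ?M" unfolding not_in_iff by simp
      with that show False by contradiction
    qed
    then show ?thesis using pair_no_loops by (force simp: indep_set_def)
  qed
  ultimately have "fold_colouring G b ?M" by (simp add: fold_colouring_def)
  then show ?thesis by blast
qed

lemma fold_chromatic_number_attained:
  assumes "pair_graph G"
  shows "\<exists>M. fold_colouring G b M \<and> size M = fold_chromatic_number G b"
  unfolding fold_chromatic_number_def
  using LeastI_ex[of "\<lambda>m. \<exists>M. fold_colouring G b M \<and> size M = m"]
    ex_fold_colouring[OF assms, of b] by blast

section \<open>Bounds at a fixed block length\<close>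

lemma approx_leakage_ge:
  assumes fin: "finite (pverts \<Theta>)" and ne: "pverts \<Theta> \<noteq> {}" and "\<beta> > 1"
    and "0 < r" "set_pmf P \<subseteq> pverts \<Theta>" "r ^ t \<le> guess_quotient \<Theta> t Y K P"
  shows "real t * log \<beta> r \<le> approx_leakage \<beta> \<Theta> t Y K"
proof -
  have "guess_quotient \<Theta> t Y K P \<le> (SUP P\<in>{P. set_pmf P \<subseteq> pverts \<Theta>}. guess_quotient \<Theta> t Y K P)"
    using assms(5) by (intro cSUP_upper guess_quotient_bdd_above fin ne) simp
  with assms(6) have "r ^ t \<le> (SUP P\<in>{P. set_pmf P \<subseteq> pverts \<Theta>}. guess_quotient \<Theta> t Y K P)"
    by (rule order.trans)
  then have "log \<beta> (r ^ t) \<le> approx_leakage \<beta> \<Theta> t Y K"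
    unfolding approx_leakage_eq using assms(3,4) by (intro log_mono) auto
  then show ?thesis using assms(3,4) by (simp add: log_nat_power)
qed

text \<open>The two bounds are proved together because each supports the other: the lower estimate
  bounds the set of leakages from below, so that its infimum is a lower bound, and the colouring
  code makes that set nonempty.\<close>

lemma opt_leakage_bounds:
  assumes \<Gamma>: "pair_graph \<Gamma>" and eq: "pverts \<Theta> = pverts \<Gamma>" and ne: "pverts \<Gamma> \<noteq> {}"
    and \<beta>: "\<beta> > 1"
    and f_nonneg: "\<And>x. x \<in> pverts \<Theta> \<Longrightarrow> 0 \<le> f x"
    and f_le: "\<And>x. x \<in> pverts \<Theta> \<Longrightarrow> (\<Sum>x'\<in>closed_nbhd \<Theta> x. f x') \<le> 1"
    and f_pos: "0 < (\<Sum>x\<in>pverts \<Theta>. f x)"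
    and c_pos: "0 < c"
    and c: "\<And>T. T \<in> max_indep_sets \<Gamma> \<Longrightarrow> fractional_covering_number (assoc_hypergraph \<Theta> T) < c"
    and b: "0 < b"
  shows "real t * log \<beta> ((\<Sum>x\<in>pverts \<Theta>. f x) / c) \<le> opt_leakage \<beta> \<Gamma> \<Theta> t"
    and "opt_leakage \<beta> \<Gamma> \<Theta> t \<le> real t * log \<beta> (real (fold_chromatic_number \<Gamma> b) / real b)"
proof -
  interpret pair_graph \<Gamma> by fact
  have fin: "finite (pverts \<Theta>)" and ne': "pverts \<Theta> \<noteq> {}"
    using pair_finite_verts eq ne by auto
  let ?L = "{approx_leakage \<beta> \<Theta> t Y K | Y K. valid_mapping \<Gamma> t Y K}"
  let ?r = "(\<Sum>x\<in>pverts \<Theta>. f x) / c"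
  have r: "0 < ?r" using f_pos c_pos by simp
  have quot: "\<exists>P. set_pmf P \<subseteq> pverts \<Theta> \<and> ?r ^ t \<le> guess_quotient \<Theta> t Y K P"
    if "valid_mapping \<Gamma> t Y K" for Y K
    using guess_quotient_ge[OF fin ne' eq that f_nonneg f_le f_pos c_pos c] by blast
  then have lower: "real t * log \<beta> ?r \<le> l" if "l \<in> ?L" for l
    using that approx_leakage_ge[OF fin ne' \<beta> r] by blast
  obtain M where M: "fold_colouring \<Gamma> b M" "size M = fold_chromatic_number \<Gamma> b"
    using fold_chromatic_number_attained[OF \<Gamma>] by blast
  obtain Y K where YK: "valid_mapping \<Gamma> t Y K" "card Y = size M ^ t"
    "\<forall>x\<in>words (pverts \<Gamma>) t. \<forall>y\<in>Y. pmf (K x) y \<le> 1 / real b ^ t"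
    using ex_valid_mapping_of_colouring[OF pair_finite_verts M(1) b] by blast
  have "approx_leakage \<beta> \<Theta> t Y K \<in> ?L" using YK(1) by blast
  then have inf: "real t * log \<beta> ?r \<le> Inf ?L" "Inf ?L \<le> approx_leakage \<beta> \<Theta> t Y K"
    using lower by (auto intro!: cInf_greatest cInf_lower bdd_belowI)
  then show "real t * log \<beta> ?r \<le> opt_leakage \<beta> \<Gamma> \<Theta> t" by (simp add: opt_leakage_def)
  let ?q = "real (fold_chromatic_number \<Gamma> b) / real b"
  let ?sup = "SUP P\<in>{P. set_pmf P \<subseteq> pverts \<Theta>}. guess_quotient \<Theta> t Y K P"
  obtain P where P: "set_pmf P \<subseteq> pverts \<Theta>" "?r ^ t \<le> guess_quotient \<Theta> t Y K P"
    using quot[OF YK(1)] by blast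
  have quot_le: "guess_quotient \<Theta> t Y K P \<le> ?q ^ t" for P
  proof -
    have "guess_quotient \<Theta> t Y K P \<le> real (card Y) * (1 / real b ^ t)"
      using YK(3) eq by (intro guess_quotient_le fin ne') auto
    then show ?thesis by (simp add: YK(2) M(2) power_divide)
  qed
  \<comment> \<open>Monotonicity of the logarithm requires a positive supremum, which the lower
    estimate provides.\<close>
  have "0 < ?r ^ t" using r by (rule zero_less_power)
  also have "\<dots> \<le> guess_quotient \<Theta> t Y K P" by (rule P(2))
  also have "\<dots> \<le> ?sup"
    using P(1) by (intro cSUP_upper guess_quotient_bdd_above fin ne') simp
  finally have sup_pos: "0 < ?sup" .
  have sup_le: "?sup \<le> ?q ^ t" using P(1) quot_le by (intro cSUP_least) auto
  \<comment> \<open>Positivity of \<open>?q\<close> follows from that of its power except at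
    \<open>t = 0\<close>, where \<open>log \<beta> (?q ^ t)\<close> and
    \<open>real t * log \<beta> ?q\<close> are both 0.\<close>
  have "0 < q \<or> t = 0" if "0 < q ^ t" "0 \<le> q" for q :: real
    using that by (cases "q = 0") (auto simp: power_0_left split: if_splits)
  from this[OF less_le_trans[OF sup_pos sup_le]] have "0 < ?q \<or> t = 0" by simp
  then have "log \<beta> (?q ^ t) = real t * log \<beta> ?q" using \<beta> by (auto simp: log_nat_power)
  moreover have "approx_leakage \<beta> \<Theta> t Y K \<le> log \<beta> (?q ^ t)"
    unfolding approx_leakage_eq using \<beta> sup_pos sup_le by (intro log_mono) auto
  ultimately show "opt_leakage \<beta> \<Gamma> \<Theta> t \<le> real t * log \<beta> ?q"
    using inf(2) by (simp add: opt_leakage_def)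
qed

section \<open>Passage to the limit and optimisation over packings, coverings and colourings\<close>

theorem theorem3:
  fixes \<Gamma> \<Theta> :: "'a pair_pre_digraph" and \<beta> :: real
  assumes "pair_graph \<Gamma>" and "pair_graph \<Theta>"
    and "pverts \<Theta> = pverts \<Gamma>" and "pverts \<Gamma> \<noteq> {}"
    and "\<beta> > 1"
    and "convergent (\<lambda>t. opt_leakage \<beta> \<Gamma> \<Theta> t / real t)"
  shows "log \<beta> (fractional_packing_number \<Theta> /
                (MAX T\<in>max_indep_sets \<Gamma>. fractional_covering_number (assoc_hypergraph \<Theta> T)))
           \<le> leakage_rate \<beta> \<Gamma> \<Theta>
       \<and> leakage_rate \<beta> \<Gamma> \<Theta> \<le> log \<beta> (fractional_chromatic_number \<Gamma>)"
proof -
  interpret \<Gamma>: pair_graph \<Gamma> by fact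
  interpret \<Theta>: pair_graph \<Theta> by fact
  define \<kappa> where "\<kappa> = (MAX T\<in>max_indep_sets \<Gamma>. fractional_covering_number (assoc_hypergraph \<Theta> T))"
  define L where "L = leakage_rate \<beta> \<Gamma> \<Theta>"
  let ?V = "pverts \<Theta>"
  let ?F = "{w :: 'a \<Rightarrow> real. (\<forall>x\<in>?V. 0 \<le> w x \<and> w x \<le> 1) \<and> (\<forall>x\<in>?V. (\<Sum>x'\<in>closed_nbhd \<Theta> x. w x') \<le> 1)}"
  have fin: "finite ?V" and ne: "?V \<noteq> {}" using \<Theta>.pair_finite_verts assms(3,4) by auto
  have lim: "(\<lambda>t. opt_leakage \<beta> \<Gamma> \<Theta> t / real t) \<longlonglongrightarrow> L"
    using assms(6) unfolding L_def leakage_rate_def by (simp add: convergent_LIMSEQ_iff)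
  have fin_max: "finite (max_indep_sets \<Gamma>)" by (rule finite_max_indep_sets) simp
  have covering_le: "fractional_covering_number (assoc_hypergraph \<Theta> T) \<le> \<kappa>"
    if "T \<in> max_indep_sets \<Gamma>" for T
    unfolding \<kappa>_def using fin_max that by (intro Max_ge) auto
  obtain T where T: "T \<in> max_indep_sets \<Gamma>"
    using ex_max_indep_set_superset[of \<Gamma> "{}"] by (auto simp: indep_set_def)
  have "1 \<le> fractional_covering_number (assoc_hypergraph \<Theta> T)"
    using T assms(3) max_indep_set_nonempty[OF assms(1,4) T]
    by (intro fractional_covering_number_ge_1 fin) (auto simp: max_indep_sets_def indep_set_def)
  with covering_le[OF T] have \<kappa>: "1 \<le> \<kappa>" by simp
  \<comment> \<open>The uniform distribution is a feasible packing of total weight 1. It keeps the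
    packing number positive and provides the packing that the upper bound calls for.\<close>
  define u :: "'a \<Rightarrow> real" where "u = (\<lambda>_. 1 / real (card ?V))"
  have card_pos: "0 < card ?V" using fin ne by (simp add: card_gt_0_iff)
  have u_sum: "(\<Sum>x\<in>?V. u x) = 1" using fin ne by (simp add: u_def)
  have u: "u \<in> ?F"
  proof -
    have "(\<Sum>x'\<in>closed_nbhd \<Theta> x. u x') \<le> (\<Sum>x\<in>?V. u x)" for x
      by (intro sum_mono2 fin closed_nbhd_subset) (simp add: u_def)
    then show ?thesis using u_sum card_pos ne by (simp add: u_def)
  qed
  \<comment> \<open>At \<open>t = 0\<close> the ratio is 0 by convention, so the estimates start at
    \<open>t = 1\<close>, which suffices for the limit. The value \<open>b = 1\<close> supplies the
    colouring that makes the infimum range over a nonempty set.\<close>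
  have seq_ge: "log \<beta> ((\<Sum>x\<in>?V. f x) / c) \<le> opt_leakage \<beta> \<Gamma> \<Theta> t / real t"
    if "f \<in> ?F" "0 < (\<Sum>x\<in>?V. f x)" "\<kappa> < c" "1 \<le> t" for f c t
  proof -
    have "real t * log \<beta> ((\<Sum>x\<in>?V. f x) / c) \<le> opt_leakage \<beta> \<Gamma> \<Theta> t"
    proof (rule opt_leakage_bounds(1)[OF assms(1,3,4,5) _ _ that(2) _ _ zero_less_one])
      show "0 < c" using that(3) \<kappa> by simp
      show "fractional_covering_number (assoc_hypergraph \<Theta> T) < c"
        if "T \<in> max_indep_sets \<Gamma>" for T
        using covering_le[OF that] \<open>\<kappa> < c\<close> by simp
    qed (use that(1) in simp_all)
    then show ?thesis using that(4) by (simp add: pos_le_divide_eq mult.commute)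
  qed
  have seq_le: "opt_leakage \<beta> \<Gamma> \<Theta> t / real t \<le> log \<beta> (real (fold_chromatic_number \<Gamma> b) / real b)"
    if "0 < b" "1 \<le> t" for b t
  proof -
    have "opt_leakage \<beta> \<Gamma> \<Theta> t \<le> real t * log \<beta> (real (fold_chromatic_number \<Gamma> b) / real b)"
    \<comment> \<open>Here \<open>u\<close> and \<open>\<kappa> + 1\<close> furnish the lower
      estimate that keeps the infimum meaningful.\<close>
    proof (rule opt_leakage_bounds(2)[OF assms(1,3,4,5) _ _ _ _ _ \<open>0 < b\<close>])
      show "0 < (\<Sum>x\<in>?V. u x)" "0 < \<kappa> + 1" using u_sum \<kappa> by simp_all
      show "fractional_covering_number (assoc_hypergraph \<Theta> T) < \<kappa> + 1"
        if "T \<in> max_indep_sets \<Gamma>" for T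
        using covering_le[OF that] by simp
    qed (use u in simp_all)
    then show ?thesis using that(2) by (simp add: pos_divide_le_eq mult.commute)
  qed
  \<comment> \<open>The multiplicative form lets the supremum over packings be taken directly. If it
    failed, some \<open>c\<close> would fit strictly between \<open>\<kappa>\<close> and
    \<open>p / \<beta> powr L\<close>, and the limit of \<open>seq_ge\<close> for this
    \<open>c\<close> would give \<open>p / c \<le> \<beta> powr L\<close>.\<close>
  have packing_le: "(\<Sum>x\<in>?V. f x) \<le> \<kappa> * \<beta> powr L" if f: "f \<in> ?F" for f
  proof (rule ccontr)
    define p where "p = (\<Sum>x\<in>?V. f x)"
    assume "\<not> (\<Sum>x\<in>?V. f x) \<le> \<kappa> * \<beta> powr L"
    then have "\<kappa> < p / \<beta> powr L" using assms(5) by (simp add: p_def less_divide_eq)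
    then obtain c where c: "\<kappa> < c" "c < p / \<beta> powr L" using dense by blast
    have cp: "0 < c" "c * \<beta> powr L < p"
      using c \<kappa> assms(5) by (auto simp: less_divide_eq)
    have "0 < c * \<beta> powr L" using cp(1) assms(5) by simp
    with cp(2) have p: "0 < p" by linarith
    have "log \<beta> (p / c) \<le> L"
      using seq_ge[OF f, folded p_def, OF p c(1)]
      by (intro LIMSEQ_le_const[OF lim]) blast
    then have "p / c \<le> \<beta> powr L" using assms(5) p cp(1) by (simp add: log_le_iff)
    then show False using cp by (simp add: divide_le_eq mult.commute)
  qed
  have packing: "fractional_packing_number \<Theta> = Sup ((\<lambda>w. \<Sum>x\<in>?V. w x) ` ?F)"
    unfolding fractional_packing_number_def by (rule arg_cong[of _ _ Sup]) blast
  have "fractional_packing_number \<Theta> \<le> \<kappa> * \<beta> powr L"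
    unfolding packing using u packing_le by (intro cSUP_least) auto
  moreover have "1 \<le> fractional_packing_number \<Theta>"
  proof -
    have "bdd_above ((\<lambda>w. \<Sum>x\<in>?V. w x) ` ?F)" by (rule bdd_aboveI2) (rule packing_le)
    from cSUP_upper[OF u this] show ?thesis unfolding packing u_sum .
  qed
  ultimately have lower: "log \<beta> (fractional_packing_number \<Theta> / \<kappa>) \<le> L"
    using \<kappa> assms(5) by (simp add: log_le_iff divide_le_eq mult.commute)
  have "\<beta> powr L \<le> real (fold_chromatic_number \<Gamma> b) / real b" if b: "b \<in> {1..}" for b
  proof -
    have "0 < b" using b by simp
    then have "L \<le> log \<beta> (real (fold_chromatic_number \<Gamma> b) / real b)"
      using seq_le by (intro LIMSEQ_le_const2[OF lim]) blast
    \<comment> \<open>Any vertex lies in \<open>b\<close> colour classes, so there are at least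
      \<open>b\<close> of them; positivity allows exponentiating the logarithmic bound before taking
      the infimum over \<open>b\<close>.\<close>
    moreover have "0 < real (fold_chromatic_number \<Gamma> b) / real b"
    proof -
      obtain M where M: "fold_colouring \<Gamma> b M" "size M = fold_chromatic_number \<Gamma> b"
        using fold_chromatic_number_attained[OF assms(1)] by blast
      obtain v where "v \<in> pverts \<Gamma>" using assms(4) by auto
      then have "size {#S \<in># M. v \<in> S#} = b" using M(1) by (simp add: fold_colouring_def)
      then have "b \<le> size M" by (metis multiset_filter_subset size_mset_mono)
      then show ?thesis using b M(2) by simp
    qed
    ultimately show ?thesis using assms(5) by (simp add: le_log_iff)
  qed
  then have "\<beta> powr L \<le> fractional_chromatic_number \<Gamma>"
    unfolding fractional_chromatic_number_def by (intro cINF_greatest) auto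
  moreover have "0 < \<beta> powr L" using assms(5) by simp
  then have "0 < fractional_chromatic_number \<Gamma>" using calculation by (rule less_le_trans)
  ultimately have "L \<le> log \<beta> (fractional_chromatic_number \<Gamma>)"
    using assms(5) by (simp add: le_log_iff)
  with lower show ?thesis unfolding L_def \<kappa>_def ..
qed

end
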